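(* Let $t$ be a positive real number and let $G$ be a minimally $t$-tough $P_4$-free graph. Then $G$ has a vertex of degree $\lceil 2t\rceil$.
   Context: All graphs are finite, simple, and undirected. A graph is $P_4$-free if it has no induced subgraph isomorphic to the four-vertex path $P_4$. For a graph $H$, $c(H)$ denotes the number of connected components of $H$. A set $S\subseteq V(G)$ is a separator of $G$ if $c(G-S)\ge 2$. The toughness $\tau(G)$ of a graph $G$ is the minimum of $|S|/c(G-S)$ over all separators $S$ of $G$, with $\tau(G)=\infty$ if $G$ has no separators, that is, if $G$ is complete. A graph $G$ is minimally $t$-tough if $\tau(G)=t$ and $\tau(G-e)<t$ for every edge $e$ of $G$. *)

theory Defs
  imports "HOL-Library.Extended_Real"
begin

record 'a graph =
  verts :: "'a set"
  edges :: "'a set set"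

definition simple_graph :: "'a graph \<Rightarrow> bool" where
  "simple_graph G \<longleftrightarrow> finite (verts G) \<and> (\<forall>e\<in>edges G. e \<subseteq> verts G \<and> card e = 2)"

definition vertex_degree :: "'a graph \<Rightarrow> 'a \<Rightarrow> nat" where
  "vertex_degree G v = card {e \<in> edges G. v \<in> e}"

definition induced_subgraph :: "'a graph \<Rightarrow> 'a set \<Rightarrow> 'a graph" where
  "induced_subgraph G W = \<lparr>verts = W, edges = {e \<in> edges G. e \<subseteq> W}\<rparr>"

definition delete_verts :: "'a graph \<Rightarrow> 'a set \<Rightarrow> 'a graph" where
  "delete_verts G S = induced_subgraph G (verts G - S)"

definition delete_edge :: "'a graph \<Rightarrow> 'a set \<Rightarrow> 'a graph" where
  "delete_edge G e = \<lparr>verts = verts G, edges = edges G - {e}\<rparr>"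

definition graph_iso :: "'a graph \<Rightarrow> 'b graph \<Rightarrow> bool" where
  "graph_iso G H \<longleftrightarrow> (\<exists>f. bij_betw f (verts G) (verts H) \<and>
     (\<forall>u\<in>verts G. \<forall>v\<in>verts G. {u, v} \<in> edges G \<longleftrightarrow> {f u, f v} \<in> edges H))"

definition path_graph :: "nat \<Rightarrow> nat graph" where
  "path_graph n = \<lparr>verts = {..<n}, edges = {{i, Suc i} | i. Suc i < n}\<rparr>"

definition P4_free :: "'a graph \<Rightarrow> bool" where
  "P4_free G \<longleftrightarrow> \<not> (\<exists>W\<subseteq>verts G. graph_iso (induced_subgraph G W) (path_graph 4))"

definition connected_rel :: "'a graph \<Rightarrow> ('a \<times> 'a) set" where
  "connected_rel G =
     {(u, v). u \<in> verts G \<and> v \<in> verts G \<and> (u, v) \<in> {(x, y). {x, y} \<in> edges G}\<^sup>*}"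

definition connected_components :: "'a graph \<Rightarrow> 'a set set" where
  "connected_components G = verts G // connected_rel G"

definition num_components :: "'a graph \<Rightarrow> nat" where
  "num_components G = card (connected_components G)"

definition separator :: "'a graph \<Rightarrow> 'a set \<Rightarrow> bool" where
  "separator G S \<longleftrightarrow> S \<subseteq> verts G \<and> num_components (delete_verts G S) \<ge> 2"

definition toughness :: "'a graph \<Rightarrow> ereal" where
  "toughness G =
     (if \<exists>S. separator G S
      then ereal (Min {real (card S) / real (num_components (delete_verts G S)) | S. separator G S})
      else \<infinity>)"

definition minimally_tough :: "real \<Rightarrow> 'a graph \<Rightarrow> bool" where
  "minimally_tough t G \<longleftrightarrow>
     toughness G = ereal t \<and> (\<forall>e\<in>edges G. toughness (delete_edge G e) < ereal t)"

end

theory Submission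
  imports Defs
begin

text \<open>
  If the toughness \<open>t\<close> is finite and positive, every separator has at least \<open>2 t\<close> elements, and
  hence every vertex has degree at least \<open>2 t\<close> (lemma \<open>vertex_degree_ge\<close>). The point is therefore
  to find a vertex of degree less than \<open>2 t + 1\<close>.

  A connected \<open>P\<^sub>4\<close>-free graph with an edge has a \<^emph>\<open>dominating\<close> edge \<open>u v\<close>: every vertex is
  adjacent to \<open>u\<close> or to \<open>v\<close> (lemma \<open>dominating_edge_if_P4_free\<close>). By minimality, \<open>G - u v\<close> has a
  separator \<open>S\<close> with \<open>|S| / c < t\<close>, where \<open>c\<close> is the number of components that \<open>S\<close> leaves. It
  contains neither \<open>u\<close> nor \<open>v\<close>, because otherwise deleting \<open>S\<close> would also delete the edge and \<open>S\<close>
  would violate the toughness of \<open>G\<close>. Since \<open>u v\<close> is dominating, each remaining vertex lies in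
  the component of \<open>u\<close> or in that of \<open>v\<close>, so \<open>c = 2\<close> and \<open>|S| < 2 t\<close>. Thus \<open>u v\<close> is a bridge of
  \<open>G - S\<close>. Were both ends to have a further neighbour outside \<open>S\<close>, these four vertices would
  induce a \<open>P\<^sub>4\<close>. Hence for one of the ends all neighbours but the other end lie in \<open>S\<close>, and its
  degree is at most \<open>|S| + 1 < 2 t + 1\<close> (lemma \<open>dominating_edge_end_of_small_degree\<close>).
\<close>

section \<open>Connectivity and components\<close>

definition reachable :: "'a graph \<Rightarrow> 'a \<Rightarrow> 'a \<Rightarrow> bool" where
  "reachable G x y \<longleftrightarrow> (x, y) \<in> {(x, y). {x, y} \<in> edges G}\<^sup>*"

lemma reachable_refl [simp]: "reachable G x x"
  by (simp add: reachable_def)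

lemma reachable_edge: "{x, y} \<in> edges G \<Longrightarrow> reachable G x y"
  by (auto simp: reachable_def)

lemma reachable_trans: "reachable G x y \<Longrightarrow> reachable G y z \<Longrightarrow> reachable G x z"
  unfolding reachable_def by (rule rtrancl_trans)

lemma reachable_sym: "reachable G x y \<Longrightarrow> reachable G y x"
proof -
  have "sym {(x, y). {x, y} \<in> edges G}"
    by (auto simp: sym_def insert_commute)
  then show "reachable G x y \<Longrightarrow> reachable G y x"
    unfolding reachable_def by (meson sym_rtrancl symD)
qed

lemma reachable_leaves_set:
  assumes "reachable G x y" "x \<in> D" "y \<notin> D"
  obtains a b where "a \<in> D" "b \<notin> D" "{a, b} \<in> edges G"
proof -
  have "(x, y) \<in> {(x, y). {x, y} \<in> edges G}\<^sup>*"
    using assms(1) by (simp add: reachable_def)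
  then have "y \<notin> D \<Longrightarrow> \<exists>a b. a \<in> D \<and> b \<notin> D \<and> {a, b} \<in> edges G"
    using assms(2) by (induction rule: rtrancl_induct) auto
  then show thesis using assms(3) that by blast
qed

lemma equiv_connected_rel: "equiv (verts G) (connected_rel G)"
proof (rule equivI)
  show "connected_rel G \<subseteq> verts G \<times> verts G"
    by (auto simp: connected_rel_def)
  show "refl_on (verts G) (connected_rel G)"
    by (auto simp: connected_rel_def refl_on_def)
  show "sym (connected_rel G)"
    using reachable_sym by (auto simp: connected_rel_def sym_def reachable_def)
  show "trans (connected_rel G)"
    by (auto simp: connected_rel_def trans_def)
qed

lemma connected_rel_iff:
  "(x, y) \<in> connected_rel G \<longleftrightarrow> x \<in> verts G \<and> y \<in> verts G \<and> reachable G x y"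
  by (auto simp: connected_rel_def reachable_def)

lemma num_components_ge_2_iff:
  assumes "finite (verts G)"
  shows "num_components G \<ge> 2 \<longleftrightarrow> (\<exists>x\<in>verts G. \<exists>y\<in>verts G. \<not> reachable G x y)"
proof -
  have fin: "finite (connected_components G)"
    unfolding connected_components_def quotient_def using assms by simp
  have "num_components G \<ge> 2 \<longleftrightarrow> (\<exists>X\<in>connected_components G. \<exists>Y\<in>connected_components G. X \<noteq> Y)"
    unfolding num_components_def using card_le_Suc0_iff_eq[OF fin] by (auto simp: not_less_eq_eq)
  also have "\<dots> \<longleftrightarrow> (\<exists>x\<in>verts G. \<exists>y\<in>verts G. connected_rel G `` {x} \<noteq> connected_rel G `` {y})"
    by (auto simp: connected_components_def quotient_def)
  also have "\<dots> \<longleftrightarrow> (\<exists>x\<in>verts G. \<exists>y\<in>verts G. \<not> reachable G x y)"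
    using eq_equiv_class_iff[OF equiv_connected_rel] by (metis connected_rel_iff)
  finally show ?thesis .
qed

lemma num_components_le_2:
  assumes "u \<in> verts G" "v \<in> verts G"
    and "\<And>x. x \<in> verts G \<Longrightarrow> reachable G u x \<or> reachable G v x"
  shows "num_components G \<le> 2"
proof -
  have "connected_components G \<subseteq> {connected_rel G `` {u}, connected_rel G `` {v}}"
  proof
    fix X assume "X \<in> connected_components G"
    then obtain x where x: "x \<in> verts G" "X = connected_rel G `` {x}"
      by (auto simp: connected_components_def elim: quotientE)
    then have "(u, x) \<in> connected_rel G \<or> (v, x) \<in> connected_rel G"
      using assms connected_rel_iff by metis
    then show "X \<in> {connected_rel G `` {u}, connected_rel G `` {v}}"
      using x(2) equiv_class_eq[OF equiv_connected_rel] by (metis insertCI)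
  qed
  then have "num_components G \<le> card {connected_rel G `` {u}, connected_rel G `` {v}}"
    unfolding num_components_def by (intro card_mono) auto
  also have "\<dots> \<le> 2" by (simp add: card_insert_if)
  finally show ?thesis .
qed

section \<open>Toughness\<close>

lemma verts_delete_verts [simp]: "verts (delete_verts G S) = verts G - S"
  by (simp add: delete_verts_def induced_subgraph_def)

lemma separator_iff:
  assumes "finite (verts G)"
  shows "separator G S \<longleftrightarrow>
    S \<subseteq> verts G \<and> (\<exists>x\<in>verts G - S. \<exists>y\<in>verts G - S. \<not> reachable (delete_verts G S) x y)"
  using assms by (simp add: separator_def num_components_ge_2_iff)

lemma finite_separator_ratios:
  assumes "finite (verts G)"
  shows "finite {real (card S) / real (num_components (delete_verts G S)) | S. separator G S}"
proof -
  have "{S. separator G S} \<subseteq> Pow (verts G)" by (auto simp: separator_def)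
  then have "finite {S. separator G S}" using assms by (meson finite_Pow_iff finite_subset)
  then show ?thesis by (simp add: setcompr_eq_image)
qed

lemma toughness_le_ratio:
  assumes "finite (verts G)" "separator G S"
  shows "toughness G \<le> ereal (real (card S) / real (num_components (delete_verts G S)))"
  using assms(2) Min_le[OF finite_separator_ratios[OF assms(1)]]
  by (auto simp: toughness_def)

lemma toughness_less_imp_separator:
  assumes "finite (verts G)" "toughness G < ereal t"
  obtains S where "separator G S"
    "real (card S) / real (num_components (delete_verts G S)) < t"
proof -
  let ?R = "{real (card S) / real (num_components (delete_verts G S)) | S. separator G S}"
  have ex: "\<exists>S. separator G S" and less: "Min ?R < t"
    using assms(2) by (auto simp: toughness_def split: if_splits)
  have "Min ?R \<in> ?R"
    using ex by (intro Min_in finite_separator_ratios assms(1)) auto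
  then show thesis using less that by auto
qed

lemma toughness_finite_imp_separator:
  assumes "toughness G = ereal t"
  obtains S where "separator G S"
  using assms by (auto simp: toughness_def split: if_splits)

lemma card_separator_ge:
  assumes "finite (verts G)" "toughness G = ereal t" "t \<ge> 0" "separator G S"
  shows "2 * t \<le> real (card S)"
proof -
  let ?c = "real (num_components (delete_verts G S))"
  have c: "?c \<ge> 2" using assms(4) by (simp add: separator_def)
  have "t \<le> real (card S) / ?c"
    using toughness_le_ratio[OF assms(1,4)] assms(2) by simp
  then have "t * ?c \<le> real (card S)" using c by (simp add: field_simps)
  moreover have "t * 2 \<le> t * ?c" using c assms(3) by (intro mult_left_mono) auto
  ultimately show ?thesis by linarith
qed

text \<open>In a disconnected graph the empty set is a separator, of ratio zero.\<close>

lemma reachable_if_toughness_pos: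
  assumes "finite (verts G)" "toughness G = ereal t" "t > 0" "x \<in> verts G" "y \<in> verts G"
    and "simple_graph G"
  shows "reachable G x y"
proof (rule ccontr)
  assume "\<not> reachable G x y"
  moreover have "delete_verts G {} = G"
    using assms(6) by (cases G) (auto simp: delete_verts_def induced_subgraph_def simple_graph_def)
  ultimately have "separator G {}"
    using assms(1,4,5) by (auto simp: separator_iff)
  from card_separator_ge[OF assms(1,2) _ this] show False using assms(3) by simp
qed

section \<open>Vertex degrees\<close>

lemma vertex_degree_eq_card_neighbours:
  assumes "simple_graph G"
  shows "vertex_degree G v = card {x. {v, x} \<in> edges G}"
proof -
  have "{e \<in> edges G. v \<in> e} = (\<lambda>x. {v, x}) ` {x. {v, x} \<in> edges G}" (is "?L = ?R")
  proof
    show "?L \<subseteq> ?R"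
    proof
      fix e assume e: "e \<in> ?L"
      then have "card e = 2" using assms by (auto simp: simple_graph_def)
      then obtain x where "e = {v, x}" using e by (auto simp: card_2_iff)
      then show "e \<in> ?R" using e by auto
    qed
  qed auto
  moreover have "inj_on (\<lambda>x. {v, x}) {x. {v, x} \<in> edges G}"
    by (auto simp: inj_on_def doubleton_eq_iff)
  ultimately show ?thesis by (simp add: vertex_degree_def card_image)
qed

lemma simple_graph_edgeD:
  assumes "simple_graph G" "{x, y} \<in> edges G"
  shows "x \<in> verts G" "y \<in> verts G" "x \<noteq> y"
  using assms by (force simp: simple_graph_def)+

text \<open>
  The neighbourhood of a vertex that is not universal separates it from the rest of the graph. A
  universal vertex has degree one less than the number of vertices, and no separator contains all
  vertices.
\<close>

lemma vertex_degree_ge: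
  assumes G: "simple_graph G" and t: "toughness G = ereal t" "t > 0" and v: "v \<in> verts G"
  shows "2 * t \<le> real (vertex_degree G v)"
proof -
  let ?N = "{x. {v, x} \<in> edges G}"
  have fin: "finite (verts G)" using G by (simp add: simple_graph_def)
  have N: "?N \<subseteq> verts G - {v}" using simple_graph_edgeD[OF G] by blast
  show ?thesis
  proof (cases "?N = verts G - {v}")
    case True
    obtain S where S: "separator G S" using toughness_finite_imp_separator[OF t(1)] .
    then have "S \<subset> verts G" using fin by (auto simp: separator_iff)
    from psubset_card_mono[OF fin this] have "card S \<le> card (verts G) - 1" by linarith
    also have "\<dots> = vertex_degree G v"
      unfolding vertex_degree_eq_card_neighbours[OF G] True using fin v by simp
    finally show ?thesis using card_separator_ge[OF fin t(1) _ S] t(2) by linarith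
  next
    case False
    then obtain w where w: "w \<in> verts G" "w \<noteq> v" "w \<notin> ?N" using N by blast
    have "\<not> reachable (delete_verts G ?N) v w"
    proof
      assume "reachable (delete_verts G ?N) v w"
      then obtain a b where "a = v" "{a, b} \<in> edges (delete_verts G ?N)"
        using w(2) by (elim reachable_leaves_set[where D = "{v}"]) auto
      then show False by (auto simp: delete_verts_def induced_subgraph_def)
    qed
    then have "separator G ?N"
      using N w v fin by (auto simp: separator_iff)
    from card_separator_ge[OF fin t(1) _ this] show ?thesis
      using t(2) by (simp add: vertex_degree_eq_card_neighbours[OF G])
  qed
qed

section \<open>Induced paths and dominating edges\<close>

lemma edges_path_graph_4: "edges (path_graph 4) = {{0, 1}, {1, 2}, {2, 3}}"
proof -
  have "Suc i < 4 \<longleftrightarrow> i = 0 \<or> i = 1 \<or> i = 2" for i by auto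
  then have "edges (path_graph 4) = {{i, Suc i} | i. i = 0 \<or> i = 1 \<or> i = 2}"
    by (simp add: path_graph_def)
  then show ?thesis by (auto simp: numeral_eq_Suc)
qed

lemma P4_free_path_has_chord:
  assumes G: "simple_graph G" and free: "P4_free G"
    and edge: "{a, b} \<in> edges G" "{b, c} \<in> edges G" "{c, d} \<in> edges G"
  shows "{a, c} \<in> edges G \<or> {a, d} \<in> edges G \<or> {b, d} \<in> edges G"
proof (rule ccontr)
  assume chordless: "\<not> ?thesis"
  have dist: "a \<noteq> b" "b \<noteq> c" "c \<noteq> d"
    using simple_graph_edgeD(3)[OF G] edge by blast+
  have edge': "{b, a} \<in> edges G" "{c, b} \<in> edges G" "{d, c} \<in> edges G"
    using edge by (simp_all add: insert_commute)
  have nonedge: "{a, c} \<notin> edges G" "{a, d} \<notin> edges G" "{b, d} \<notin> edges G"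
    using chordless by simp_all
  then have nonedge': "{c, a} \<notin> edges G" "{d, a} \<notin> edges G" "{d, b} \<notin> edges G"
    by (simp_all add: insert_commute)
  have dist': "a \<noteq> c" "a \<noteq> d" "b \<noteq> d"
    using edge edge' nonedge by blast+
  have no_loop: "{x} \<notin> edges G" for x
    using G by (auto simp: simple_graph_def)
  define f where "f x = (if x = a then 0 else if x = b then 1 else if x = c then 2 else 3 :: nat)" for x
  have f: "f a = 0" "f b = 1" "f c = 2" "f d = 3"
    using dist dist' by (simp_all add: f_def)
  have "{..<4} = {0, 1, 2, 3 :: nat}" by auto
  then have "bij_betw f {a, b, c, d} (verts (path_graph 4))"
    by (auto simp: bij_betw_def inj_on_def f path_graph_def)
  moreover have "\<forall>x\<in>{a, b, c, d}. \<forall>y\<in>{a, b, c, d}.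
      {x, y} \<in> edges (induced_subgraph G {a, b, c, d}) \<longleftrightarrow> {f x, f y} \<in> edges (path_graph 4)"
    by (simp add: f edge edge' nonedge nonedge' no_loop edges_path_graph_4 induced_subgraph_def
        doubleton_eq_iff)
  ultimately have "graph_iso (induced_subgraph G {a, b, c, d}) (path_graph 4)"
    unfolding graph_iso_def
    by (intro exI[of _ f]) (simp only: induced_subgraph_def graph.select_convs simp_thms)
  moreover have "{a, b, c, d} \<subseteq> verts G"
    using simple_graph_edgeD[OF G] edge by simp
  ultimately show False using free unfolding P4_free_def by blast
qed

text \<open>
  Any edge \<open>u v\<close> whose ends have the largest number of neighbours in total is dominating. If it were
  not, a vertex \<open>w\<close> at distance one from the dominated set would be adjacent to a vertex \<open>x\<close> of that
  set. Avoiding an induced path through \<open>w, x, u, v\<close> forces \<open>x\<close> to be adjacent to both \<open>u\<close> and \<open>v\<close>.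
  Avoiding induced paths again, the edge \<open>u x\<close> then dominates everything that \<open>u v\<close> does, and \<open>w\<close> in
  addition.
\<close>

lemma dominating_edge_if_P4_free:
  assumes G: "simple_graph G" and free: "P4_free G"
    and conn: "\<And>x y. x \<in> verts G \<Longrightarrow> y \<in> verts G \<Longrightarrow> reachable G x y"
    and nonempty: "edges G \<noteq> {}"
  obtains u v where "{u, v} \<in> edges G"
    "\<And>w. w \<in> verts G \<Longrightarrow> {u, w} \<in> edges G \<or> {v, w} \<in> edges G"
proof -
  let ?D = "\<lambda>(u, v). {w. {u, w} \<in> edges G \<or> {v, w} \<in> edges G}"
  let ?E = "{(u, v). {u, v} \<in> edges G}"
  have fin: "finite (verts G)" using G by (simp add: simple_graph_def)
  have "?E \<subseteq> verts G \<times> verts G" using simple_graph_edgeD[OF G] by auto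
  then have finE: "finite ?E" using fin by (meson finite_SigmaI finite_subset)
  have Dsub: "?D p \<subseteq> verts G" for p using simple_graph_edgeD[OF G] by (auto split: prod.splits)
  obtain e where "e \<in> edges G" using nonempty by blast
  moreover from this have "card e = 2" using G by (simp add: simple_graph_def)
  ultimately have "?E \<noteq> {}" by (auto simp: card_2_iff)
  then have "Max ((\<lambda>p. card (?D p)) ` ?E) \<in> (\<lambda>p. card (?D p)) ` ?E"
    using finE by (intro Max_in) auto
  then obtain p where p: "p \<in> ?E" "Max ((\<lambda>p. card (?D p)) ` ?E) = card (?D p)"
    by (rule imageE)
  obtain u v where uv: "p = (u, v)" by (cases p)
  have uv_max: "card (?D q) \<le> card (?D (u, v))" if "q \<in> ?E" for q
    unfolding uv[symmetric] p(2)[symmetric] using finE that by (intro Max_ge) auto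
  have e: "{u, v} \<in> edges G" using p(1) uv by simp
  have chord: "{a, c} \<in> edges G \<or> {a, d} \<in> edges G \<or> {b, d} \<in> edges G"
    if "{a, b} \<in> edges G" "{b, c} \<in> edges G" "{c, d} \<in> edges G" for a b c d
    using P4_free_path_has_chord[OF G free that] .
  \<comment> \<open>The exchange step is symmetric in the two ends, so it is stated for an arbitrary orientation.\<close>
  have no_outside: False
    if e: "{u, v} \<in> edges G" and max: "\<And>q. q \<in> ?E \<Longrightarrow> card (?D q) \<le> card (?D (u, v))"
      and x: "{u, x} \<in> edges G" and w: "{x, w} \<in> edges G" "w \<notin> ?D (u, v)" for u v x w
  proof -
    have uw: "{u, w} \<notin> edges G" and vw: "{v, w} \<notin> edges G" using w(2) by auto
    have xv: "{x, v} \<in> edges G"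
      using chord[of w x u v] w(1) x e uw vw by (auto simp: insert_commute)
    have "?D (u, v) \<subseteq> ?D (u, x)"
    proof
      fix y assume y: "y \<in> ?D (u, v)"
      show "y \<in> ?D (u, x)"
      proof (rule ccontr)
        assume "y \<notin> ?D (u, x)"
        then have uy: "{u, y} \<notin> edges G" and xy: "{x, y} \<notin> edges G" by auto
        have vy: "{v, y} \<in> edges G" using y uy by auto
        have "{w, y} \<in> edges G"
          using chord[of w x v y] w(1) xv vy vw xy by (auto simp: insert_commute)
        then show False
          using chord[of u x w y] x w(1) uw uy xy by (auto simp: insert_commute)
      qed
    qed
    moreover have "w \<in> ?D (u, x)" using w(1) by simp
    ultimately have "card (?D (u, v)) < card (?D (u, x))"
      using w(2) by (intro psubset_card_mono finite_subset[OF Dsub fin]) auto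
    moreover have "(u, x) \<in> ?E" using x by simp
    ultimately show False using max[of "(u, x)"] by linarith
  qed
  have "verts G \<subseteq> ?D (u, v)"
  proof
    fix z assume z: "z \<in> verts G"
    show "z \<in> ?D (u, v)"
    proof (rule ccontr)
      assume z': "z \<notin> ?D (u, v)"
      have u: "u \<in> verts G" "u \<in> ?D (u, v)"
        using e simple_graph_edgeD[OF G] by (auto simp: insert_commute)
      obtain x w where xw: "x \<in> ?D (u, v)" "w \<notin> ?D (u, v)" "{x, w} \<in> edges G"
        using reachable_leaves_set[OF conn[OF u(1) z] u(2) z'] .
      have swap: "?D (v, u) = ?D (u, v)" by auto
      from xw(1) consider "{u, x} \<in> edges G" | "{v, x} \<in> edges G" by auto
      then show False
      proof cases
        case 1
        show ?thesis using no_outside[OF e uv_max 1 xw(3,2)] .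
      next
        case 2
        have "{v, u} \<in> edges G" using e by (simp add: insert_commute)
        from no_outside[OF this _ 2 xw(3)] show ?thesis
          using uv_max xw(2) unfolding swap by blast
      qed
    qed
  qed
  then show thesis using that e by auto
qed

section \<open>A vertex of small degree\<close>

text \<open>
  Removing an end of an edge removes the edge as well, so a set containing an end leaves the same
  graph behind in \<open>G\<close> as in \<open>G - e\<close>, and its ratio there is at least \<open>t\<close>.
\<close>

lemma separator_delete_edge_avoids_ends:
  assumes G: "simple_graph G" and t: "toughness G = ereal t" and e: "e \<in> edges G"
    and S: "separator (delete_edge G e) S"
      "real (card S) / real (num_components (delete_verts (delete_edge G e) S)) < t"
  shows "e \<inter> S = {}"
proof (rule ccontr)
  assume "e \<inter> S \<noteq> {}"
  then have eq: "delete_verts (delete_edge G e) S = delete_verts G S"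
    by (auto simp: delete_verts_def induced_subgraph_def delete_edge_def)
  then have "separator G S" using S(1) by (simp add: separator_def delete_edge_def)
  then show False
    using toughness_le_ratio[of G S] t S(2) G unfolding eq by (simp add: simple_graph_def)
qed

text \<open>
  In general a separator that witnesses the drop of toughness only satisfies \<open>|S| < c t\<close> with an
  unknown number \<open>c\<close> of components. A dominating edge forces \<open>c = 2\<close>, since the ends survive and
  every other surviving vertex is still adjacent to one of them.
\<close>

lemma dominating_edge_end_of_small_degree:
  assumes G: "simple_graph G" and free: "P4_free G" and t: "toughness G = ereal t" "t > 0"
    and e: "{u, v} \<in> edges G"
    and dom: "\<And>w. w \<in> verts G \<Longrightarrow> {u, w} \<in> edges G \<or> {v, w} \<in> edges G"
    and drop: "toughness (delete_edge G {u, v}) < ereal t"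
  shows "\<exists>w\<in>{u, v}. real (vertex_degree G w) < 2 * t + 1"
proof -
  let ?G = "delete_edge G {u, v}"
  have fin: "finite (verts G)" using G by (simp add: simple_graph_def)
  have uv: "u \<in> verts G" "v \<in> verts G" "u \<noteq> v" using simple_graph_edgeD[OF G e] .
  have fin': "finite (verts ?G)" using fin by (simp add: delete_edge_def)
  obtain S where S: "separator ?G S"
    and ratio: "real (card S) / real (num_components (delete_verts ?G S)) < t"
    using toughness_less_imp_separator[OF fin' drop] .
  let ?H = "delete_verts ?G S"
  have "{u, v} \<inter> S = {}" by (rule separator_delete_edge_avoids_ends[OF G t(1) e S ratio])
  then have notS: "u \<notin> S" "v \<notin> S" by auto
  have SV: "S \<subseteq> verts G" using S by (simp add: separator_def delete_edge_def)
  have finS: "finite S" using SV fin by (rule finite_subset)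
  have eH: "{a, b} \<in> edges ?H" if "{a, b} \<in> edges G" "{a, b} \<noteq> {u, v}" "a \<notin> S" "b \<notin> S" for a b
    using that simple_graph_edgeD[OF G that(1)]
    by (auto simp: delete_verts_def induced_subgraph_def delete_edge_def)
  have uvH: "u \<in> verts ?H" "v \<in> verts ?H" using uv notS by (simp_all add: delete_edge_def)
  have reach: "reachable ?H u x \<or> reachable ?H v x" if x: "x \<in> verts ?H" for x
  proof (cases "x = u \<or> x = v")
    case False
    then have "{u, x} \<noteq> {u, v}" "{v, x} \<noteq> {u, v}" by (auto simp: doubleton_eq_iff)
    moreover have "x \<in> verts G" "x \<notin> S" using x by (simp_all add: delete_edge_def)
    ultimately show ?thesis using dom[of x] eH[of u x] eH[of v x] notS reachable_edge by metis
  qed auto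
  have sep: "\<not> reachable ?H u v"
  proof
    assume *: "reachable ?H u v"
    have from_u: "reachable ?H u x" if "x \<in> verts ?H" for x
      using reach[OF that] reachable_trans[OF *] by blast
    have "reachable ?H x y" if "x \<in> verts ?H" "y \<in> verts ?H" for x y
      using reachable_trans[OF reachable_sym[OF from_u[OF that(1)]] from_u[OF that(2)]] .
    then show False using S unfolding separator_iff[OF fin'] verts_delete_verts by blast
  qed
  have "num_components ?H \<le> 2" using num_components_le_2[OF uvH reach] .
  moreover have "num_components ?H \<ge> 2" using S by (simp add: separator_def)
  ultimately have "num_components ?H = 2" by linarith
  then have cardS: "real (card S) < 2 * t" using ratio by (simp add: field_simps)
  \<comment> \<open>Further neighbours of both ends outside \<open>S\<close> would be the ends of an induced path whose middle
    edge is the bridge, as a chord would join \<open>u\<close> to \<open>v\<close> around the bridge.\<close>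
  have pendant: "{x. {u, x} \<in> edges G} \<subseteq> insert v S \<or> {x. {v, x} \<in> edges G} \<subseteq> insert u S"
  proof (rule ccontr)
    assume "\<not> ?thesis"
    then obtain x y where x: "{u, x} \<in> edges G" "x \<notin> S" "x \<noteq> v"
      and y: "{v, y} \<in> edges G" "y \<notin> S" "y \<noteq> u" by blast
    have nx: "x \<noteq> u" and ny: "y \<noteq> v"
      using simple_graph_edgeD[OF G x(1)] simple_graph_edgeD[OF G y(1)] by auto
    have ux: "reachable ?H u x" using eH[OF x(1)] x nx notS
      by (intro reachable_edge) (auto simp: doubleton_eq_iff)
    have yv: "reachable ?H y v" using eH[OF y(1)] y ny notS
      by (intro reachable_sym[OF reachable_edge]) (auto simp: doubleton_eq_iff)
    have noedge: "{a, b} \<notin> edges G"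
      if "reachable ?H u a" "reachable ?H b v" "a \<notin> S" "b \<notin> S" "{a, b} \<noteq> {u, v}" for a b
    proof
      assume "{a, b} \<in> edges G"
      from reachable_edge[OF eH[OF this that(5,3,4)]] show False
        using sep reachable_trans[OF reachable_trans[OF that(1)] that(2)] by blast
    qed
    have "{x, v} \<notin> edges G" using noedge[OF ux reachable_refl] x nx notS
      by (auto simp: doubleton_eq_iff)
    moreover have "{x, y} \<notin> edges G" using noedge[OF ux yv] x nx y ny
      by (auto simp: doubleton_eq_iff)
    moreover have "{u, y} \<notin> edges G" using noedge[OF reachable_refl yv] y ny notS
      by (auto simp: doubleton_eq_iff)
    ultimately show False
      using P4_free_path_has_chord[OF G free _ e y(1), of x] x(1) by (simp add: insert_commute)
  qed
  have small: "real (vertex_degree G w) < 2 * t + 1"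
    if "{x. {w, x} \<in> edges G} \<subseteq> insert w' S" for w w'
  proof -
    have "vertex_degree G w \<le> card (insert w' S)"
      unfolding vertex_degree_eq_card_neighbours[OF G] using that finS by (intro card_mono) auto
    also have "\<dots> \<le> card S + 1" using finS by (simp add: card_insert_if)
    finally show ?thesis using cardS by linarith
  qed
  show ?thesis using pendant small by blast
qed

theorem corollary6p3:
  fixes G :: "'a graph" and t :: real
  assumes "simple_graph G"
    and "t > 0"
    and "minimally_tough t G"
    and "P4_free G"
  shows "\<exists>v\<in>verts G. int (vertex_degree G v) = \<lceil>2 * t\<rceil>"
proof -
  have fin: "finite (verts G)" using assms(1) by (simp add: simple_graph_def)
  have t: "toughness G = ereal t"
    and drop: "\<And>e. e \<in> edges G \<Longrightarrow> toughness (delete_edge G e) < ereal t"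
    using assms(3) by (auto simp: minimally_tough_def)
  have conn: "reachable G x y" if "x \<in> verts G" "y \<in> verts G" for x y
    using reachable_if_toughness_pos[OF fin t assms(2) that assms(1)] .
  have "edges G \<noteq> {}"
  proof -
    obtain S where "separator G S" using toughness_finite_imp_separator[OF t] .
    then obtain x y where xy: "x \<in> verts G" "y \<in> verts G" "x \<noteq> y"
      using fin by (metis DiffD1 reachable_refl separator_iff)
    from conn[OF xy(1,2)] obtain a b where "{a, b} \<in> edges G"
      by (rule reachable_leaves_set[where D = "{x}"]) (use xy(3) in auto)
    then show ?thesis by blast
  qed
  then obtain u v where e: "{u, v} \<in> edges G"
    and dom: "\<And>w. w \<in> verts G \<Longrightarrow> {u, w} \<in> edges G \<or> {v, w} \<in> edges G"
    using dominating_edge_if_P4_free[OF assms(1,4) conn] by blast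
  obtain w where w: "w \<in> {u, v}" "real (vertex_degree G w) < 2 * t + 1"
    using dominating_edge_end_of_small_degree[OF assms(1,4) t assms(2) e dom drop[OF e]] by blast
  have wV: "w \<in> verts G" using w(1) simple_graph_edgeD[OF assms(1) e] by blast
  have "\<lceil>2 * t\<rceil> = int (vertex_degree G w)"
    using vertex_degree_ge[OF assms(1) t assms(2) wV] w(2) by (intro ceiling_unique) auto
  then show ?thesis using wV by auto
qed

end
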